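(* Let $v$ be a $\mathbb{Q}$-valued Goussarov-Polyak-Viro (GPV) finite-type invariant (i.e. of GPV finite type $\le n$ for some $n$) of virtual knots, or of long virtual knots. If $v$ is invariant under the virtualization move, then $v$ is constant. More specifically, if $v$ is a nonconstant $\mathbb{Q}$-valued GPV finite-type invariant of virtual knots (respectively, of long virtual knots), then there are virtual knots (respectively, long virtual knots) $K$ and $K'$ such that $K$ and $K'$ are obtained from one another by a virtualization move and $v(K)\neq v(K')$.
   Context: A Gauss diagram is an oriented circle $S^1$ (the case of virtual knots) or an oriented line $\mathbb{R}$ (the case of long virtual knots) together with finitely many arrows, each joining an ordered pair (tail, head) of points of the circle/line, all endpoints being distinct, each arrow carrying a sign $\oplus$ or $\ominus$; diagrams are considered up to orientation-preserving homeomorphism of the circle/line. A (long) virtual knot diagram determines a Gauss diagram with one arrow for each classical crossing, pointing from the overpassing arc to the underpassing arc and carrying the sign of the crossing. Every Gauss diagram arises in this way, and diagrams with the same Gauss diagram are virtually isotopic; accordingly virtual knots (resp. long virtual knots) are identified with equivalence classes of Gauss diagrams on the circle (resp. line) under the following Reidemeister moves. Two endpoints are called adjacent if there is an arc of the circle/line between them containing no other endpoint. R1: insert or delete an arrow (of any sign and direction) whose two endpoints are adjacent. R2: insert or delete two arrows $a,b$ of opposite signs such that the tails of $a$ and $b$ are adjacent and the heads of $a$ and $b$ are adjacent (the two orders in which $a,b$ occur along the two arcs are arbitrary). R3: suppose there are three arrows $a,b,c$ of the same sign $\varepsilon$ and three disjoint arcs $s_1,s_2,s_3$ (in any position along the circle/line),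 which contain no other endpoints and such that along the orientation $s_1$ contains tail of $a$, then tail of $b$; $s_2$ contains head of $a$, then tail of $c$; $s_3$ contains head of $b$, then head of $c$. The move reverses the order of the two endpoints on each of $s_1,s_2,s_3$, and this can also be undone. Virtualization move: on a Gauss diagram, it reverses the direction of one arrow while keeping its sign (and everything else) unchanged. Two (long) virtual knots are obtained from one another by a virtualization move if they have representing Gauss diagrams related by such a move. An invariant is invariant under the virtualization move if it takes equal values on any two such knots. GPV finite type: a (long) virtual knot invariant $v$ (a function on equivalence classes of Gauss diagrams) is extended to diagrams with semivirtual crossings by $v(\text{semivirtual}) = v(\text{classical crossing}) - v(\text{virtual crossing})$; in terms of Gauss diagrams, replacing a crossing by a virtual one deletes the corresponding arrow. $v$ is of GPV finite type $\le n$ if $v$ vanishes on all diagrams with more than $n$ semivirtual crossings; equivalently, for every Gauss diagram $D$ and every set $S$ of more than $n$ arrows of $D$, $\sum_{T\subset S}(-1)^{|T|}v(D\setminus T)=0$, where $D\setminus T$ is $D$ with the arrows in $T$ deleted. *)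

theory Defs
  imports Complex_Main
begin

datatype sign = Positive | Negative

datatype end_kind = Tail | Head

datatype endpoint = Endpoint (arrow: nat) (kind: end_kind) (arrow_sign: sign)

text \<open>A Gauss diagram on the line is encoded by the word of arrow endpoints met along the
  orientation; the arrows carry names in \<^typ>\<open>nat\<close>.  A Gauss diagram on the circle is encoded
  by the word obtained after cutting the circle at a point that is not an endpoint.  The choices
  of names and of the cutting point are divided out below.\<close>

type_synonym gauss_word = "endpoint list"

definition gauss_diagram :: "gauss_word \<Rightarrow> bool" where
  "gauss_diagram D \<longleftrightarrow> distinct D \<and>
     (\<forall>a \<in> arrow ` set D. \<exists>s. {x \<in> set D. arrow x = a} = {Endpoint a Tail s, Endpoint a Head s})"

definition arrows :: "gauss_word \<Rightarrow> nat set" where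
  "arrows D = arrow ` set D"

definition delete_arrows :: "nat set \<Rightarrow> gauss_word \<Rightarrow> gauss_word" where
  "delete_arrows T D = filter (\<lambda>x. arrow x \<notin> T) D"

definition relabel :: "(nat \<Rightarrow> nat) \<Rightarrow> gauss_word \<Rightarrow> gauss_word" where
  "relabel f D = map (\<lambda>x. Endpoint (f (arrow x)) (kind x) (arrow_sign x)) D"

text \<open>In \<open>R2\<close>, \<open>k\<close> is the kind of the endpoints on the first of the two arcs, and \<open>a\<close> is the arrow
  met first there.  In \<open>R3\<close>, the arcs \<open>s\<^sub>1\<close>, \<open>s\<^sub>2\<close>, \<open>s\<^sub>3\<close> occur along the line in the arbitrary
  order \<open>p\<^sub>1\<close>, \<open>p\<^sub>2\<close>, \<open>p\<^sub>3\<close>.  In each rule, distinctness of the arrow names involved is enforced by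
  \<open>gauss_diagram\<close>, which is imposed on both sides of a move in \<open>long_equiv\<close> and
  \<open>closed_equiv\<close>.\<close>

inductive move :: "gauss_word \<Rightarrow> gauss_word \<Rightarrow> bool" where
  relabelling: "inj_on f (arrows D) \<Longrightarrow> move D (relabel f D)"
| R1: "k \<noteq> k' \<Longrightarrow> move (u @ w) (u @ [Endpoint a k s, Endpoint a k' s] @ w)"
| R2: "k \<noteq> k' \<Longrightarrow> s \<noteq> s' \<Longrightarrow>
       q = [Endpoint a k' s, Endpoint b k' s'] \<or> q = [Endpoint b k' s', Endpoint a k' s] \<Longrightarrow>
       move (u @ w @ z) (u @ [Endpoint a k s, Endpoint b k s'] @ w @ q @ z)"
| R3: "s\<^sub>1 = [Endpoint a Tail e, Endpoint b Tail e] \<Longrightarrow>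
       s\<^sub>2 = [Endpoint a Head e, Endpoint c Tail e] \<Longrightarrow>
       s\<^sub>3 = [Endpoint b Head e, Endpoint c Head e] \<Longrightarrow>
       {p\<^sub>1, p\<^sub>2, p\<^sub>3} = {s\<^sub>1, s\<^sub>2, s\<^sub>3} \<Longrightarrow>
       move (u @ p\<^sub>1 @ w @ p\<^sub>2 @ y @ p\<^sub>3 @ z) (u @ rev p\<^sub>1 @ w @ rev p\<^sub>2 @ y @ rev p\<^sub>3 @ z)"

definition long_equiv :: "gauss_word \<Rightarrow> gauss_word \<Rightarrow> bool" where
  "long_equiv D D' \<longleftrightarrow> gauss_diagram D \<and> gauss_diagram D' \<and>
     equivclp (\<lambda>x y. gauss_diagram x \<and> gauss_diagram y \<and> move x y) D D'"

definition closed_equiv :: "gauss_word \<Rightarrow> gauss_word \<Rightarrow> bool" where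
  "closed_equiv D D' \<longleftrightarrow> gauss_diagram D \<and> gauss_diagram D' \<and>
     equivclp (\<lambda>x y. gauss_diagram x \<and> gauss_diagram y \<and> (move x y \<or> y = rotate1 x)) D D'"

lemma gauss_diagram_Nil: "gauss_diagram []"
  by (simp add: gauss_diagram_def)

lemma part_equivp_equivclp:
  assumes "P x"
  shows "part_equivp (\<lambda>x y. P x \<and> P y \<and> equivclp r x y)"
proof (rule part_equivpI)
  show "\<exists>x. P x \<and> P x \<and> equivclp r x x" using assms by auto
  show "symp (\<lambda>x y. P x \<and> P y \<and> equivclp r x y)"
    by (auto intro: sympI equivclp_sym)
  show "transp (\<lambda>x y. P x \<and> P y \<and> equivclp r x y)"
    by (auto intro: transpI equivclp_trans)
qed

quotient_type long_virtual_knot = gauss_word / partial: long_equiv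
  morphisms rep_long_virtual_knot long_knot_of
  unfolding long_equiv_def by (rule part_equivp_equivclp[of gauss_diagram, OF gauss_diagram_Nil])

quotient_type virtual_knot = gauss_word / partial: closed_equiv
  morphisms rep_virtual_knot knot_of
  unfolding closed_equiv_def by (rule part_equivp_equivclp[of gauss_diagram, OF gauss_diagram_Nil])

text \<open>The notions below serve both cases: \<open>cls\<close> is the map sending a Gauss diagram to its class,
  i.e. \<open>knot_of\<close> or \<open>long_knot_of\<close>.  These maps are meaningful only on words satisfying
  \<open>gauss_diagram\<close>; deletion of arrows and virtualization preserve this property.\<close>

definition GPV_finite_type_le :: "(gauss_word \<Rightarrow> 'k) \<Rightarrow> nat \<Rightarrow> ('k \<Rightarrow> rat) \<Rightarrow> bool" where
  "GPV_finite_type_le cls n v \<longleftrightarrow>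
     (\<forall>D S. gauss_diagram D \<and> S \<subseteq> arrows D \<and> card S > n \<longrightarrow>
        (\<Sum>T\<in>Pow S. (-1) ^ card T * v (cls (delete_arrows T D))) = 0)"

definition GPV_finite_type :: "(gauss_word \<Rightarrow> 'k) \<Rightarrow> ('k \<Rightarrow> rat) \<Rightarrow> bool" where
  "GPV_finite_type cls v \<longleftrightarrow> (\<exists>n. GPV_finite_type_le cls n v)"

fun opposite :: "end_kind \<Rightarrow> end_kind" where
  "opposite Tail = Head"
| "opposite Head = Tail"

definition virtualize :: "nat \<Rightarrow> gauss_word \<Rightarrow> gauss_word" where
  "virtualize a D =
     map (\<lambda>x. if arrow x = a then Endpoint a (opposite (kind x)) (arrow_sign x) else x) D"

definition virtualization_related :: "(gauss_word \<Rightarrow> 'k) \<Rightarrow> 'k \<Rightarrow> 'k \<Rightarrow> bool" where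
  "virtualization_related cls K K' \<longleftrightarrow>
     (\<exists>D. \<exists>a \<in> arrows D. gauss_diagram D \<and> K = cls D \<and> K' = cls (virtualize a D))"

definition virtualization_invariant :: "(gauss_word \<Rightarrow> 'k) \<Rightarrow> ('k \<Rightarrow> rat) \<Rightarrow> bool" where
  "virtualization_invariant cls v \<longleftrightarrow>
     (\<forall>K K'. virtualization_related cls K K' \<longrightarrow> v K = v K')"

definition is_constant :: "('k \<Rightarrow> rat) \<Rightarrow> bool" where
  "is_constant v \<longleftrightarrow> (\<exists>c. \<forall>K. v K = c)"

lemma gauss_diagram_delete_arrows:
  assumes "gauss_diagram D"
  shows "gauss_diagram (delete_arrows T D)"
  unfolding gauss_diagram_def
proof (intro conjI ballI)
  show "distinct (delete_arrows T D)"
    using assms by (simp add: gauss_diagram_def delete_arrows_def)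
  fix a assume "a \<in> arrow ` set (delete_arrows T D)"
  then have a: "a \<in> arrow ` set D" "a \<notin> T" by (auto simp: delete_arrows_def)
  then have "{x \<in> set (delete_arrows T D). arrow x = a} = {x \<in> set D. arrow x = a}"
    by (auto simp: delete_arrows_def)
  moreover have "\<exists>s. {x \<in> set D. arrow x = a} = {Endpoint a Tail s, Endpoint a Head s}"
    using assms a(1) unfolding gauss_diagram_def by blast
  ultimately show "\<exists>s. {x \<in> set (delete_arrows T D). arrow x = a} =
      {Endpoint a Tail s, Endpoint a Head s}"
    by metis
qed

lemma gauss_diagram_virtualize:
  assumes "gauss_diagram D"
  shows "gauss_diagram (virtualize a D)"
proof -
  define g where "g = (\<lambda>x. if arrow x = a then Endpoint a (opposite (kind x)) (arrow_sign x) else x)"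
  have v: "virtualize a D = map g D" by (simp add: virtualize_def g_def)
  have opp: "opposite (opposite k) = k" for k by (cases k) auto
  have gg: "g (g x) = x" for x by (cases x) (auto simp: g_def opp)
  have ar: "arrow (g x) = arrow x" for x by (auto simp: g_def)
  have "inj g" by (metis gg injI)
  then have "distinct (map g D)"
    using assms unfolding gauss_diagram_def distinct_map by (meson inj_on_subset subset_UNIV)
  moreover have "\<exists>s. {x \<in> set (map g D). arrow x = b} = {Endpoint b Tail s, Endpoint b Head s}"
    if b: "b \<in> arrow ` set (map g D)" for b
  proof -
    have "b \<in> arrow ` set D" using b ar by auto
    then obtain s where s: "{x \<in> set D. arrow x = b} = {Endpoint b Tail s, Endpoint b Head s}"
      using assms unfolding gauss_diagram_def by blast
    have "{x \<in> set (map g D). arrow x = b} = g ` {x \<in> set D. arrow x = b}"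
      using ar by auto
    also have "\<dots> = {Endpoint b Tail s, Endpoint b Head s}"
      unfolding s by (auto simp: g_def)
    finally show ?thesis by blast
  qed
  ultimately show ?thesis unfolding gauss_diagram_def v by blast
qed

end

theory Submission
  imports Defs "HOL-Library.Multiset" "HOL-Computational_Algebra.Polynomial"
begin

text \<open>An invariant that ignores virtualization depends only on the signed chords, not on the
  directions of the arrows.  On three strands, let \<open>A\<close>, \<open>B\<close>, \<open>C\<close> be chords of equal sign joining the
  three pairs of strands.  With directions forgotten, R3 gives \<open>ABC = CBA\<close> and \<open>ACB = BCA\<close>, hence
  \<open>AABC = ACBA = BCAA\<close>, so \<open>A\<^sup>2\<close> commutes with \<open>BC\<close>.  By finite type the difference of the values
  at \<open>A\<^sup>kBC\<close> and \<open>BCA\<^sup>k\<close> is a polynomial in \<open>k\<close>, and it vanishes at all even \<open>k\<close>, hence also at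
  \<open>k = 1\<close>: to the invariant, \<open>ABC = BCA = ACB\<close>.  Cancelling \<open>A\<close> by R2 gives \<open>BC = CB\<close>, that is,
  adjacent endpoints of any two chords may be exchanged, and then R1 removes every chord.  Rotation
  of the cutting point is never used, so the circle is covered by the argument for the line.\<close>

subsection \<open>Alternating sums over subsets\<close>

lemma sum_Pow_card:
  fixes g :: "nat \<Rightarrow> 'a::comm_semiring_1"
  assumes "finite S"
  shows "(\<Sum>T\<in>Pow S. g (card T)) = (\<Sum>j\<le>card S. of_nat (card S choose j) * g j)"
proof -
  have "(\<Sum>T\<in>Pow S. g (card T)) = (\<Sum>j\<le>card S. \<Sum>T\<in>{T \<in> Pow S. card T = j}. g (card T))"
    using assms by (intro sum.group[symmetric]) (auto intro: card_mono)
  also have "\<dots> = (\<Sum>j\<le>card S. of_nat (card S choose j) * g j)"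
  proof (rule sum.cong)
    fix j
    have "(\<Sum>T\<in>{T \<in> Pow S. card T = j}. g (card T)) = of_nat (card {T \<in> Pow S. card T = j}) * g j"
      by simp
    then show "(\<Sum>T\<in>{T \<in> Pow S. card T = j}. g (card T)) = of_nat (card S choose j) * g j"
      using n_subsets[OF assms, of j] by simp
  qed simp
  finally show ?thesis .
qed

lemma sum_Pow_complement:
  assumes "finite S"
  shows "(\<Sum>T\<in>Pow S. h (S - T)) = (\<Sum>T\<in>Pow S. h T)"
  by (rule sum.reindex_bij_witness[of _ "\<lambda>T. S - T" "\<lambda>T. S - T"]) auto

lemma choose_eq_poly:
  obtains p :: "'a::field_char_0 poly" where "\<And>m. poly p (of_nat m) = of_nat (m choose j)"
proof
  show "poly (smult (1 / fact j) (\<Prod>i = 0..<j. [:- of_nat i, 1:])) (of_nat m)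
      = (of_nat (m choose j) :: 'a)" for m
    by (simp add: binomial_gbinomial gbinomial_prod_rev poly_prod)
qed

text \<open>Newton's forward difference formula: the hypothesis kills all differences at 0 of order
  above \<open>n\<close>, so \<open>F\<close> agrees with a polynomial of degree at most
  \<open>n\<close>. Having all even numbers as roots, that polynomial is zero.\<close>

lemma vanishing_differences_imp_zero:
  fixes F :: "nat \<Rightarrow> 'a::field_char_0" and n :: nat
  assumes diff: "\<And>k. n < k \<Longrightarrow> (\<Sum>T\<in>Pow {..<k}. (- 1) ^ card T * F (card T)) = 0"
    and even: "\<And>m. F (2 * m) = 0"
  shows "F k = 0"
proof -
  \<comment> \<open>Up to the sign \<open>(- 1) ^ card S\<close>, this is the finite difference of
    \<open>F\<close> at 0 of order \<open>card S\<close>.\<close>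
  define g where "g S = (\<Sum>T\<in>Pow S. (- 1) ^ card T * F (card T))" for S :: "nat set"
  have g_card: "g S = g {..<card S}" if "finite S" for S
    unfolding g_def using that sum_Pow_card[of S "\<lambda>j. (- 1) ^ j * F j"]
      sum_Pow_card[of "{..<card S}" "\<lambda>j. (- 1) ^ j * F j"] by simp
  have F: "F k = (\<Sum>j\<le>n. of_nat (k choose j) * ((- 1) ^ j * g {..<j}))" for k
  proof -
    have "F k = F (card {..<k})" by simp
    \<comment> \<open>Moebius inversion on the lattice of subsets.\<close>
    also have "\<dots> = (\<Sum>T\<in>Pow {..<k}. (- 1) ^ card T * g T)"
      by (rule inclusion_exclusion_symmetric) (simp_all add: g_def)
    also have "\<dots> = (\<Sum>T\<in>Pow {..<k}. (- 1) ^ card T * g {..<card T})"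
    proof (rule sum.cong)
      fix T assume "T \<in> Pow {..<k}"
      then have "finite T" by (auto intro: finite_subset)
      from g_card[OF this] show "(- 1) ^ card T * g T = (- 1) ^ card T * g {..<card T}" by simp
    qed simp
    also have "\<dots> = (\<Sum>j\<le>k. of_nat (k choose j) * ((- 1) ^ j * g {..<j}))"
      using sum_Pow_card[of "{..<k}" "\<lambda>j. (- 1) ^ j * g {..<j}"] by simp
    \<comment> \<open>The range is first enlarged, since \<open>k choose j\<close> is 0 for
      \<open>j > k\<close>, and then cut down to \<open>n\<close>, where the differences stop. The
      bound no longer depends on \<open>k\<close>.\<close>
    also have "\<dots> = (\<Sum>j\<le>max k n. of_nat (k choose j) * ((- 1) ^ j * g {..<j}))"
      by (rule sum.mono_neutral_left) auto
    also have "\<dots> = (\<Sum>j\<le>n. of_nat (k choose j) * ((- 1) ^ j * g {..<j}))"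
      by (rule sum.mono_neutral_right) (auto simp: g_def diff)
    finally show ?thesis .
  qed
  have "\<exists>p :: 'a poly. \<forall>m. poly p (of_nat m) = of_nat (m choose j)" for j
    using choose_eq_poly[of j] by metis
  then obtain b :: "nat \<Rightarrow> 'a poly" where b: "poly (b j) (of_nat m) = of_nat (m choose j)" for j m
    by metis
  define p where "p = (\<Sum>j\<le>n. smult ((- 1) ^ j * g {..<j}) (b j))"
  have p: "poly p (of_nat m) = F m" for m
    by (simp add: p_def poly_sum b F[of m] mult_ac)
  have "range (\<lambda>m. of_nat (2 * m)) \<subseteq> {x. poly p x = 0}"
    using p even by (auto simp del: of_nat_mult)
  moreover have "infinite (range (\<lambda>m. of_nat (2 * m) :: 'a))"
    by (rule range_inj_infinite) (auto simp: inj_def simp del: of_nat_mult)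
  ultimately have "p = 0"
    using poly_roots_finite finite_subset by blast
  then show ?thesis using p[of k] by simp
qed

subsection \<open>Chord words\<close>

type_synonym chord = "nat \<times> sign"

definition chords :: "gauss_word \<Rightarrow> chord list" where
  "chords D = map (\<lambda>x. (arrow x, arrow_sign x)) D"

definition good :: "chord list \<Rightarrow> bool" where
  "good U \<longleftrightarrow> (\<exists>D. gauss_diagram D \<and> chords D = U)"

lemma chords_simps [simp]:
  "chords [] = []" "chords (x # D) = (arrow x, arrow_sign x) # chords D"
  "chords (D @ D') = chords D @ chords D'" "length (chords D) = length D"
  by (simp_all add: chords_def)

text \<open>Validity does not see the order of the endpoints. Hence it is checked throughout by
  moving the arrows in question to the front and peeling them off there.\<close>

lemma gauss_diagram_mset_cong:
  assumes "mset D = mset D'"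
  shows "gauss_diagram D = gauss_diagram D'"
  using mset_eq_setD[OF assms] mset_eq_imp_distinct_iff[OF assms]
  by (simp add: gauss_diagram_def)

lemma gauss_diagram_Cons_Cons:
  assumes "k \<noteq> k'"
  shows "gauss_diagram (Endpoint a k s # Endpoint a k' s # D) \<longleftrightarrow> gauss_diagram D \<and> a \<notin> arrows D"
    (is "gauss_diagram ?D \<longleftrightarrow> _")
proof -
  have kk: "{Endpoint a Tail t, Endpoint a Head t} = {Endpoint a k t, Endpoint a k' t}" for t
    using assms by (cases k; cases k') auto
  show ?thesis
  proof
    assume gd: "gauss_diagram ?D"
    then have dist: "distinct ?D" by (simp add: gauss_diagram_def)
    have "a \<in> arrow ` set ?D" by simp
    then have "\<exists>t. {x \<in> set ?D. arrow x = a} = {Endpoint a Tail t, Endpoint a Head t}"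
      using gd unfolding gauss_diagram_def by blast
    then obtain t where t: "{x \<in> set ?D. arrow x = a} = {Endpoint a k t, Endpoint a k' t}"
      using kk by metis
    have "Endpoint a k s \<in> {x \<in> set ?D. arrow x = a}" by simp
    then have "t = s" unfolding t by auto
    have notin: "a \<notin> arrows D"
    proof
      assume "a \<in> arrows D"
      then obtain x where x: "x \<in> set D" "arrow x = a" by (auto simp: arrows_def)
      then have "x \<in> {x \<in> set ?D. arrow x = a}" by simp
      then have "x = Endpoint a k s \<or> x = Endpoint a k' s" unfolding t \<open>t = s\<close> by auto
      then show False using dist x by auto
    qed
    have "\<exists>t. {x \<in> set D. arrow x = b} = {Endpoint b Tail t, Endpoint b Head t}"
      if "b \<in> arrow ` set D" for b
    proof -
      have "b \<noteq> a" using that notin by (auto simp: arrows_def)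
      then have "{x \<in> set D. arrow x = b} = {x \<in> set ?D. arrow x = b}" by auto
      moreover have "b \<in> arrow ` set ?D" using that by auto
      ultimately show ?thesis using gd unfolding gauss_diagram_def by metis
    qed
    then show "gauss_diagram D \<and> a \<notin> arrows D"
      using dist notin by (simp add: gauss_diagram_def)
  next
    assume R: "gauss_diagram D \<and> a \<notin> arrows D"
    then have notin: "\<And>x. x \<in> set D \<Longrightarrow> arrow x \<noteq> a" by (auto simp: arrows_def)
    have "\<exists>t. {x \<in> set ?D. arrow x = b} = {Endpoint b Tail t, Endpoint b Head t}"
      if "b \<in> arrow ` set ?D" for b
    proof (cases "b = a")
      case True
      then have "{x \<in> set ?D. arrow x = b} = {Endpoint b k s, Endpoint b k' s}"
        using notin by auto
      then show ?thesis using kk True by metis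
    next
      case False
      then have "{x \<in> set ?D. arrow x = b} = {x \<in> set D. arrow x = b}" by auto
      moreover have "b \<in> arrow ` set D" using that False by auto
      ultimately show ?thesis using R unfolding gauss_diagram_def by metis
    qed
    moreover have "distinct ?D" using R assms notin by (fastforce simp: gauss_diagram_def)
    ultimately show "gauss_diagram ?D" by (simp add: gauss_diagram_def)
  qed
qed

text \<open>Induction on \<open>U\<close>: any preimage of its first letter is pulled out of
  \<open>D\<close>. This carries a choice of directions along when a chord word is
  rearranged.\<close>

lemma mset_map_lift:
  assumes "mset (map g D) = mset U"
  obtains D' where "mset D' = mset D" "map g D' = U"
  using assms
proof (induction U arbitrary: D thesis)
  case Nil
  then show ?case by simp
next
  case (Cons x U)
  then have "x \<in> set (map g D)" by (metis list.set_intros(1) mset_eq_setD)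
  then obtain d where d: "d \<in> set D" "g d = x" by auto
  then obtain p q where D: "D = p @ d # q" by (meson split_list)
  then have "mset (map g (p @ q)) = mset U" using Cons.prems(2) d by simp
  then obtain D' where "mset D' = mset (p @ q)" "map g D' = U" using Cons.IH by blast
  then show ?case using Cons.prems(1)[of "d # D'"] d D by simp
qed

lemma good_mset_cong:
  assumes "mset U = mset U'"
  shows "good U = good U'"
proof -
  have "good U'" if good: "good U" and mset: "mset U = mset U'" for U U'
  proof -
    from good obtain D where D: "gauss_diagram D" "chords D = U" by (auto simp: good_def)
    then have "mset (map (\<lambda>x. (arrow x, arrow_sign x)) D) = mset U'"
      using mset by (simp only: chords_def)
    then obtain D' where D': "mset D' = mset D" "chords D' = U'"
      unfolding chords_def by (rule mset_map_lift)
    with D(1) have "gauss_diagram D'" using gauss_diagram_mset_cong[OF D'(1)] by simp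
    then show ?thesis using D'(2) by (auto simp: good_def)
  qed
  from this[OF _ assms] this[OF _ assms[symmetric]] show ?thesis by blast
qed

lemma arrows_eq_fst_chords: "arrows D = fst ` set (chords D)"
  by (auto simp: arrows_def chords_def image_image)

lemma good_Cons_Cons: "good (x # x # U) \<longleftrightarrow> good U \<and> fst x \<notin> fst ` set U"
proof
  assume "good (x # x # U)"
  then obtain D where D: "gauss_diagram D" "chords D = x # x # U" by (auto simp: good_def)
  then obtain k k' D' where D': "D = Endpoint (fst x) k (snd x) # Endpoint (fst x) k' (snd x) # D'"
    "chords D' = U"
    by (cases x; auto simp: chords_def map_eq_Cons_conv) (metis endpoint.collapse)
  with D(1) have "k \<noteq> k'" by (auto simp: gauss_diagram_def)
  then show "good U \<and> fst x \<notin> fst ` set U"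
    using D(1) D' gauss_diagram_Cons_Cons arrows_eq_fst_chords by (auto simp: good_def)
next
  assume R: "good U \<and> fst x \<notin> fst ` set U"
  then obtain D where D: "gauss_diagram D" "chords D = U" by (auto simp: good_def)
  then have "gauss_diagram (Endpoint (fst x) Tail (snd x) # Endpoint (fst x) Head (snd x) # D)"
    using R gauss_diagram_Cons_Cons arrows_eq_fst_chords by auto
  then show "good (x # x # U)" using D(2) by (force simp: good_def)
qed

text \<open>The second occurrence of \<open>x\<close> is the opposite end of the arrow that starts
  the word.\<close>

lemma good_ConsE:
  assumes "good (x # U)"
  obtains p q where "U = p @ x # q" "x \<notin> set p"
proof -
  obtain D where D: "gauss_diagram D" "chords D = x # U" using assms by (auto simp: good_def)
  then obtain k D' where D': "D = Endpoint (fst x) k (snd x) # D'" "chords D' = U"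
    by (cases x; auto simp: chords_def map_eq_Cons_conv) (metis endpoint.collapse)
  from D(1) obtain s where
    s: "{y \<in> set D. arrow y = fst x} = {Endpoint (fst x) Tail s, Endpoint (fst x) Head s}"
    unfolding gauss_diagram_def D'(1) by force
  have "Endpoint (fst x) k (snd x) \<in> {y \<in> set D. arrow y = fst x}" using D' by simp
  then have "s = snd x" unfolding s by auto
  obtain k' where "k' \<noteq> k" by (cases k) auto
  then have "Endpoint (fst x) k' s \<in> {Endpoint (fst x) Tail s, Endpoint (fst x) Head s}"
    by (cases k') auto
  then have "Endpoint (fst x) k' s \<in> set D" unfolding s[symmetric] by simp
  then have "Endpoint (fst x) k' (snd x) \<in> set D'" using D' \<open>k' \<noteq> k\<close> \<open>s = snd x\<close> by auto
  then have "x \<in> set U" using D'(2) by (force simp: chords_def)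
  then show ?thesis using that by (meson split_list_first)
qed

lemma finite_arrows [simp]: "finite (arrows D)"
  by (simp add: arrows_def)

lemma chords_eq_append_conv:
  "chords D = u @ w \<longleftrightarrow> (\<exists>u' w'. D = u' @ w' \<and> chords u' = u \<and> chords w' = w)"
  by (auto simp: chords_def map_eq_append_conv)

lemma chords_relabel: "chords (relabel g D) = map (apfst g) (chords D)"
  by (simp add: chords_def relabel_def)

lemma chords_delete_arrows:
  "chords (delete_arrows T D) = filter (\<lambda>x. fst x \<notin> T) (chords D)"
  by (induction D) (auto simp: delete_arrows_def)

lemma chords_virtualize: "chords (virtualize a D) = chords D"
  by (auto simp: chords_def virtualize_def)

lemma gauss_diagram_relabel:
  assumes "gauss_diagram D" and inj: "inj_on g (arrows D)"
  shows "gauss_diagram (relabel g D)"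
proof -
  define h where "h x = Endpoint (g (arrow x)) (kind x) (arrow_sign x)" for x
  have R: "relabel g D = map h D" by (simp add: relabel_def h_def)
  have "inj_on h (set D)"
    using inj by (auto simp: inj_on_def h_def arrows_def intro: endpoint.expand)
  then have "distinct (map h D)"
    using assms(1) by (simp add: distinct_map gauss_diagram_def)
  moreover have "\<exists>s. {x \<in> set (map h D). arrow x = b} = {Endpoint b Tail s, Endpoint b Head s}"
    if b: "b \<in> arrow ` set (map h D)" for b
  proof -
    from b obtain x where "x \<in> set D" "b = g (arrow x)" by (auto simp: h_def)
    then obtain a where a: "a \<in> arrow ` set D" "b = g a" by blast
    then obtain s where s: "{x \<in> set D. arrow x = a} = {Endpoint a Tail s, Endpoint a Head s}"
      using assms(1) unfolding gauss_diagram_def by blast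
    have "{x \<in> set (map h D). arrow x = b} = h ` {x \<in> set D. arrow x = a}"
    proof -
      have "arrow (h x) = b \<longleftrightarrow> arrow x = a" if "x \<in> set D" for x
        using a inj that by (auto simp: h_def inj_on_def arrows_def)
      then show ?thesis by auto
    qed
    also have "\<dots> = {Endpoint b Tail s, Endpoint b Head s}"
      unfolding s by (auto simp: h_def a)
    finally show ?thesis by blast
  qed
  ultimately show ?thesis unfolding gauss_diagram_def R by blast
qed

lemma end_kind_eq_opposite: "k \<noteq> k' \<Longrightarrow> k' = opposite k"
  by (cases k; cases k') auto

lemma gauss_diagram_other_end:
  assumes "gauss_diagram D" "x \<in> set D" "y \<in> set D" "arrow y = arrow x" "y \<noteq> x"
  shows "kind y = opposite (kind x)"
proof -
  obtain s where s: "{z \<in> set D. arrow z = arrow x}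
      = {Endpoint (arrow x) Tail s, Endpoint (arrow x) Head s}"
    using assms(1,2) unfolding gauss_diagram_def by blast
  have "x \<in> {z \<in> set D. arrow z = arrow x}" "y \<in> {z \<in> set D. arrow z = arrow x}"
    using assms by auto
  then have "arrow_sign x = s" "arrow_sign y = s"
    unfolding s by (metis empty_iff endpoint.sel(3) insert_iff)+
  with assms(4,5) have "kind x \<noteq> kind y" by (metis endpoint.expand)
  then show ?thesis by (rule end_kind_eq_opposite)
qed

subsection \<open>Forgetting directions\<close>

text \<open>Here \<open>f\<close> stands for the knot invariant composed with the map from words to
  classes, so that closed and long knots become two instances.\<close>

locale virtualization_invariant_finite_type =
  fixes f :: "gauss_word \<Rightarrow> rat" and n :: nat
  assumes f_move: "gauss_diagram D \<Longrightarrow> gauss_diagram D' \<Longrightarrow> move D D' \<Longrightarrow> f D' = f D"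
    and f_finite_type: "gauss_diagram D \<Longrightarrow> S \<subseteq> arrows D \<Longrightarrow> n < card S \<Longrightarrow>
      (\<Sum>T\<in>Pow S. (- 1) ^ card T * f (delete_arrows T D)) = 0"
    and f_virtualize: "gauss_diagram D \<Longrightarrow> a \<in> arrows D \<Longrightarrow> f (virtualize a D) = f D"
begin


text \<open>With equal chord words, two diagrams differ only in the directions of some arrows.
  Virtualizing one of these makes it agree in both, so induction on the number of disagreeing arrows
  applies.\<close>

lemma f_chords_cong:
  assumes "gauss_diagram D" "gauss_diagram D'" "chords D = chords D'"
  shows "f D = f D'"
proof -
  define X where "X D = {arrow (D ! i) | i. i < length D \<and> D ! i \<noteq> D' ! i}" for D
  have X: "X D \<subseteq> arrows D" for D
    by (auto simp: X_def arrows_def)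
  show ?thesis
    using assms(1,3)
  proof (induction "card (X D)" arbitrary: D rule: less_induct)
    case less
    have len: "length D = length D'" using less.prems(2) by (metis chords_simps(4))
    have same: "arrow (D ! i) = arrow (D' ! i)" "arrow_sign (D ! i) = arrow_sign (D' ! i)"
      if "i < length D" for i
      using arg_cong[OF less.prems(2), of "\<lambda>U. U ! i"] that len by (auto simp: chords_def)
    show ?case
    proof (cases "D = D'")
      case False
      then obtain i where i: "i < length D" "D ! i \<noteq> D' ! i" using len nth_equalityI by metis
      define a where "a = arrow (D ! i)"
      define E where "E = virtualize a D"
      have a: "a \<in> X D" using i by (auto simp: X_def a_def)
      \<comment> \<open>A disagreement at one end of \<open>a\<close> forces one at the other end,
        because in each diagram the two ends have opposite kinds.\<close>
      have opp: "kind (D' ! j) = opposite (kind (D ! j))" if j: "j < length D" "arrow (D ! j) = a" for j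
      proof -
        have "kind (D ! i) \<noteq> kind (D' ! i)" using i same by (metis endpoint.expand)
        note ki = end_kind_eq_opposite[OF this]
        show ?thesis
        proof (cases "j = i")
          case False
          then have "D ! j \<noteq> D ! i" "D' ! j \<noteq> D' ! i"
            using i(1) j(1) len less.prems(1) assms(2) by (auto simp: gauss_diagram_def nth_eq_iff_index_eq)
          then have "kind (D ! j) = opposite (kind (D ! i))" "kind (D' ! j) = opposite (kind (D' ! i))"
            using gauss_diagram_other_end[OF less.prems(1), of "D ! i" "D ! j"]
              gauss_diagram_other_end[OF assms(2), of "D' ! i" "D' ! j"] i j len same
            by (simp_all add: a_def)
          then show ?thesis using ki by simp
        qed (use ki in simp)
      qed
      have nthE: "E ! j = (if arrow (D ! j) = a then D' ! j else D ! j)" if "j < length D" for j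
        using that opp[of j] same[of j]
        by (auto simp: E_def virtualize_def intro!: endpoint.expand)
      have lenE: "length E = length D" by (simp add: E_def virtualize_def)
      have "X E \<subseteq> X D - {a}"
        using lenE by (auto simp: X_def nthE split: if_splits)
      then have "X E \<subset> X D" using a by blast
      moreover have "finite (X D)" using X finite_arrows by (rule finite_subset)
      ultimately have "card (X E) < card (X D)" by (rule psubset_card_mono[rotated])
      moreover have "gauss_diagram E" unfolding E_def by (rule gauss_diagram_virtualize) fact
      moreover have "chords E = chords D'" using less.prems(2) by (simp add: E_def chords_virtualize)
      ultimately have "f E = f D'" by (rule less.hyps)
      moreover have "f E = f D" unfolding E_def
        using X a less.prems(1) by (intro f_virtualize) auto
      ultimately show ?thesis by simp
    qed simp
  qed
qed

text \<open>By \<open>f_chords_cong\<close> the chosen directions do not affect the value on a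
  \<open>good\<close> word. On other words the value is unspecified, which is why goodness
  accompanies every statement about \<open>val\<close>.\<close>

definition val :: "chord list \<Rightarrow> rat" where
  "val U = f (SOME D. gauss_diagram D \<and> chords D = U)"

lemma val_chords:
  assumes "gauss_diagram D"
  shows "val (chords D) = f D"
proof -
  have "gauss_diagram (SOME E. gauss_diagram E \<and> chords E = chords D) \<and>
      chords (SOME E. gauss_diagram E \<and> chords E = chords D) = chords D"
    by (rule someI[where x = D]) (simp add: assms)
  then show ?thesis unfolding val_def using assms f_chords_cong by blast
qed

lemma val_relabel:
  assumes "good U" "inj_on g (fst ` set U)"
  shows "val (map (apfst g) U) = val U"
proof -
  obtain D where D: "gauss_diagram D" "chords D = U" using assms(1) by (auto simp: good_def)
  have inj: "inj_on g (arrows D)" using assms(2) by (simp add: arrows_eq_fst_chords D)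
  have gd: "gauss_diagram (relabel g D)" using D(1) inj by (rule gauss_diagram_relabel)
  have "f (relabel g D) = f D"
    by (rule f_move[OF D(1) gd move.relabelling[OF inj]])
  then show ?thesis
    using val_chords[OF gd] val_chords[OF D(1)] by (simp add: D chords_relabel)
qed

lemma val_finite_type:
  assumes "good U" "S \<subseteq> fst ` set U" "n < card S"
  shows "(\<Sum>T\<in>Pow S. (- 1) ^ card T * val (filter (\<lambda>x. fst x \<notin> T) U)) = 0"
proof -
  obtain D where D: "gauss_diagram D" "chords D = U" using assms(1) by (auto simp: good_def)
  have "val (filter (\<lambda>x. fst x \<notin> T) U) = f (delete_arrows T D)" for T
    using val_chords[OF gauss_diagram_delete_arrows[OF D(1)], of T]
    by (simp add: chords_delete_arrows D)
  then show ?thesis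
    using f_finite_type[OF D(1) _ assms(3)] assms(2) by (simp add: arrows_eq_fst_chords D)
qed

lemma val_R1:
  assumes "good (u @ [x, x] @ w)"
  shows "val (u @ [x, x] @ w) = val (u @ w)"
proof -
  obtain a s where x: "x = (a, s)" by (cases x)
  have "good (x # x # u @ w)" using assms by (subst good_mset_cong[of _ "u @ [x, x] @ w"]) auto
  then have "good (u @ w)" "a \<notin> fst ` set (u @ w)" by (auto simp: good_Cons_Cons x)
  then obtain D where D: "gauss_diagram D" "chords D = u @ w" "a \<notin> arrows D"
    by (auto simp: good_def arrows_eq_fst_chords)
  then obtain u' w' where uw: "D = u' @ w'" "chords u' = u" "chords w' = w"
    by (auto simp: chords_eq_append_conv)
  let ?D = "u' @ [Endpoint a Tail s, Endpoint a Head s] @ w'"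
  have "gauss_diagram (Endpoint a Tail s # Endpoint a Head s # D)"
    using D by (simp add: gauss_diagram_Cons_Cons)
  then have gd: "gauss_diagram ?D"
    by (subst gauss_diagram_mset_cong[of _ "Endpoint a Tail s # Endpoint a Head s # D"]) (simp_all add: uw)
  have "f ?D = f D"
    using D(1) gd move.R1[of Tail Head u' w' a s] unfolding uw(1) by (intro f_move) auto
  then show ?thesis
    using val_chords[OF D(1)] val_chords[OF gd] by (simp add: D uw x)
qed

text \<open>Directions are free to choose: with both tails on the first arc and both heads on the
  second, R2 applies in either order \<open>q\<close>.\<close>

lemma val_R2:
  assumes good: "good (u @ [x, y] @ w @ q @ z)" and sgn: "snd x \<noteq> snd y"
    and q: "q = [x, y] \<or> q = [y, x]"
  shows "val (u @ [x, y] @ w @ q @ z) = val (u @ w @ z)"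
proof -
  obtain a s b t where xy: "x = (a, s)" "y = (b, t)" by (cases x; cases y)
  have "good (x # x # y # y # u @ w @ z)"
    using good q by (subst good_mset_cong[of _ "u @ [x, y] @ w @ q @ z"]) auto
  then have "good (u @ w @ z)" "b \<notin> fst ` set (u @ w @ z)" "a \<noteq> b" "a \<notin> fst ` set (u @ w @ z)"
    by (auto simp: good_Cons_Cons xy)
  then obtain D where D: "gauss_diagram D" "chords D = u @ w @ z" "a \<notin> arrows D" "b \<notin> arrows D"
    by (auto simp: good_def arrows_eq_fst_chords)
  then obtain u' w' z' where uwz: "D = u' @ w' @ z'" "chords u' = u" "chords w' = w" "chords z' = z"
    by (auto simp: chords_eq_append_conv)
  define q' where "q' = (if q = [x, y] then [Endpoint a Head s, Endpoint b Head t]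
    else [Endpoint b Head t, Endpoint a Head s])"
  let ?D = "u' @ [Endpoint a Tail s, Endpoint b Tail t] @ w' @ q' @ z'"
  let ?E = "Endpoint a Tail s # Endpoint a Head s # Endpoint b Tail t # Endpoint b Head t # D"
  have "gauss_diagram ?E"
    using D \<open>a \<noteq> b\<close> by (auto simp: gauss_diagram_Cons_Cons arrows_def)
  then have gd: "gauss_diagram ?D"
    by (subst gauss_diagram_mset_cong[of _ ?E]) (simp_all add: uwz q'_def)
  have "move D ?D"
    unfolding uwz(1) using sgn by (intro move.R2[where k' = Head]) (auto simp: q'_def xy)
  then have "f ?D = f D" by (rule f_move[OF D(1) gd])
  moreover have "chords q' = q" using q by (auto simp: q'_def xy)
  ultimately show ?thesis
    using val_chords[OF D(1)] val_chords[OF gd] by (simp add: D uwz xy)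
qed

end

subsection \<open>Three strands\<close>

datatype strand = First | Second | Third

text \<open>Used to compare arcs listed by their position on the line with the same arcs listed by
  their role in R3.\<close>

lemma strand_sum:
  fixes M :: "strand \<Rightarrow> 'a::comm_monoid_add"
  assumes "h1 \<noteq> h2" "h1 \<noteq> h3" "h2 \<noteq> h3"
  shows "M h1 + M h2 + M h3 = M First + M Second + M Third"
  using assms by (cases h1; cases h2; cases h3) (simp_all add: ac_simps)

lemma strand_cover:
  assumes "h1 \<noteq> h2" "h1 \<noteq> h3" "h2 \<noteq> h3"
  shows "{h1, h2, h3} = (UNIV :: strand set)"
proof -
  have "h \<in> {h1, h2, h3}" for h
    using assms by (cases h; cases h1; cases h2; cases h3) simp_all
  then show ?thesis by auto
qed

text \<open>A letter \<open>(o, x)\<close> is a chord \<open>x\<close> that joins the two strands other than \<open>o\<close>; a word in such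
  letters plays the role of a pure braid on three strands.\<close>

type_synonym letter = "strand \<times> chord"

definition on_strand :: "letter list \<Rightarrow> strand \<Rightarrow> chord list" where
  "on_strand W h = map snd (filter (\<lambda>l. fst l \<noteq> h) W)"

lemma on_strand_simps [simp]:
  "on_strand [] h = []"
  "on_strand (l # W) h = (if fst l \<noteq> h then snd l # on_strand W h else on_strand W h)"
  "on_strand (W @ V) h = on_strand W h @ on_strand V h"
  by (simp_all add: on_strand_def)

definition rename :: "(nat \<Rightarrow> nat) \<Rightarrow> letter list \<Rightarrow> letter list" where
  "rename g W = map (apsnd (apfst g)) W"

lemma rename_simps [simp]:
  "rename g [] = []" "rename g (l # W) = (fst l, g (fst (snd l)), snd (snd l)) # rename g W"
  "rename g (W @ V) = rename g W @ rename g V"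
  by (auto simp: rename_def apsnd_def apfst_def map_prod_def split: prod.split)

lemma on_strand_rename: "on_strand (rename g W) h = map (apfst g) (on_strand W h)"
  by (induction W) (auto simp: apfst_def map_prod_def split: prod.split)

definition names :: "letter list \<Rightarrow> nat set" where
  "names W = fst ` snd ` set W"

lemma names_simps [simp]:
  "names [] = {}" "names (l # W) = insert (fst (snd l)) (names W)"
  "names (W @ V) = names W \<union> names V"
  by (auto simp: names_def)

lemma rename_cong_id: "(\<And>a. a \<in> names W \<Longrightarrow> g a = a) \<Longrightarrow> rename g W = W"
  by (induction W) auto

lemma filter_id_on_names:
  "names W \<inter> T = {} \<Longrightarrow> filter (\<lambda>l. fst (snd l) \<notin> T) W = W"
  by (induction W) auto

lemma filter_on_strand:
  "filter (\<lambda>x. fst x \<notin> T) (on_strand W h) = on_strand (filter (\<lambda>l. fst (snd l) \<notin> T) W) h"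
  by (induction W) auto

text \<open>The arcs carrying the three strands occur along the line in the order \<open>h1\<close>, \<open>h2\<close>, \<open>h3\<close>.\<close>

locale strand_context = virtualization_invariant_finite_type +
  fixes u w y z :: "chord list" and h1 h2 h3 :: strand
  assumes order: "h1 \<noteq> h2" "h1 \<noteq> h3" "h2 \<noteq> h3"
begin

definition fill :: "letter list \<Rightarrow> chord list" where
  "fill W = u @ on_strand W h1 @ w @ on_strand W h2 @ y @ on_strand W h3 @ z"

definition base_names :: "nat set" where
  "base_names = fst ` set (u @ w @ y @ z)"

text \<open>Each letter is missing from exactly one of the three strands, so its chord enters the
  filled word twice.\<close>

lemma mset_fill:
  "mset (fill W) = mset (concat (map (\<lambda>l. [snd l, snd l]) W) @ u @ w @ y @ z)"
proof (induction W)
  case Nil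
  then show ?case by (simp add: fill_def)
next
  case (Cons l W)
  have "fst l \<in> {h1, h2, h3}" using strand_cover[OF order] by auto
  then have "mset (fill (l # W)) = {#snd l, snd l#} + mset (fill W)"
    using order by (auto simp: fill_def)
  then show ?case using Cons by simp
qed

lemma fst_set_fill: "fst ` set (fill W) = names W \<union> base_names"
proof -
  have "set (fill W) = snd ` set W \<union> set (u @ w @ y @ z)"
    using mset_eq_setD[OF mset_fill[of W]] by auto
  then show ?thesis by (simp add: names_def base_names_def image_Un)
qed

lemma good_fill_cong: "mset W = mset V \<Longrightarrow> good (fill W) = good (fill V)"
proof (rule good_mset_cong)
  assume "mset W = mset V"
  then have "mset (concat (map (\<lambda>l. [snd l, snd l]) W)) = mset (concat (map (\<lambda>l. [snd l, snd l]) V))"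
    by (simp add: mset_concat flip: sum_mset_sum_list image_mset.compositionality)
  then show "mset (fill W) = mset (fill V)" by (simp add: mset_fill)
qed

lemma good_fill_Cons:
  "good (fill (l # W)) \<longleftrightarrow> good (fill W) \<and> fst (snd l) \<notin> names W \<union> base_names"
proof -
  have "mset (fill (l # W)) = mset (snd l # snd l # fill W)"
    by (simp add: mset_fill)
  then have "good (fill (l # W)) \<longleftrightarrow> good (snd l # snd l # fill W)"
    by (rule good_mset_cong)
  then show ?thesis by (simp add: good_Cons_Cons fst_set_fill)
qed

lemma good_fill_append:
  "good (fill (W @ V)) \<longleftrightarrow> good (fill W) \<and> good (fill V) \<and> names W \<inter> names V = {}"
proof (induction W)
  case Nil
  have "good (fill [])" if "good (fill V)"
    using that by (induction V) (auto simp: good_fill_Cons)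
  then show ?case by auto
next
  case (Cons l W)
  then show ?case by (auto simp: good_fill_Cons)
qed

lemma val_fill_rename:
  assumes "good (fill W)" "inj_on g (names W \<union> base_names)" "\<And>a. a \<in> base_names \<Longrightarrow> g a = a"
  shows "val (fill (rename g W)) = val (fill W)"
proof -
  have id: "map (apfst g) v = v" if "fst ` set v \<subseteq> base_names" for v :: "chord list"
    using that assms(3) by (intro map_idI) (auto intro!: prod_eqI)
  have "map (apfst g) v = v" if "v \<in> {u, w, y, z}" for v
    using that by (intro id) (auto simp: base_names_def)
  then have "map (apfst g) (fill W) = fill (rename g W)"
    by (simp add: fill_def on_strand_rename)
  then show ?thesis
    using val_relabel[OF assms(1), of g] assms(2) by (simp add: fst_set_fill)
qed

text \<open>Both letters omit strand \<open>i\<close>, so each of the other two strands carries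
  \<open>x\<close> and \<open>x'\<close> side by side. The cases only record where these two strands
  lie.\<close>

lemma val_fill_R2:
  assumes "good (fill (W @ [(i, x), (i, x')] @ V))" "snd x \<noteq> snd x'"
  shows "val (fill (W @ [(i, x), (i, x')] @ V)) = val (fill (W @ V))"
proof -
  have "i \<in> {h1, h2, h3}" using strand_cover[OF order] by auto
  then consider "i = h1" | "i = h2" | "i = h3" by blast
  then show ?thesis
  proof cases
    case 1
    then show ?thesis
      using assms order
        val_R2[of "u @ on_strand W h1 @ on_strand V h1 @ w @ on_strand W h2" x x'
          "on_strand V h2 @ y @ on_strand W h3" "[x, x']" "on_strand V h3 @ z"]
      by (simp add: fill_def)
  next
    case 2
    then show ?thesis
      using assms order
        val_R2[of "u @ on_strand W h1" x x'
          "on_strand V h1 @ w @ on_strand W h2 @ on_strand V h2 @ y @ on_strand W h3"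
          "[x, x']" "on_strand V h3 @ z"]
      by (simp add: fill_def)
  next
    case 3
    then show ?thesis
      using assms order
        val_R2[of "u @ on_strand W h1" x x' "on_strand V h1 @ w @ on_strand W h2"
          "[x, x']" "on_strand V h2 @ y @ on_strand W h3 @ on_strand V h3 @ z"]
      by (simp add: fill_def)
  qed
qed

text \<open>Each strand carries two of the three chords in the order of the letters, so reversing
  the letters reverses three arcs at once, as R3 does. The directions required by R3 can be chosen
  freely.\<close>

lemma val_fill_R3:
  assumes good: "good (fill (W @ [(o1, x1), (o2, x2), (o3, x3)] @ V))"
    and o: "o1 \<noteq> o2" "o1 \<noteq> o3" "o2 \<noteq> o3" and sgn: "snd x1 = e" "snd x2 = e" "snd x3 = e"
  shows "val (fill (W @ [(o1, x1), (o2, x2), (o3, x3)] @ V))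
    = val (fill (W @ [(o3, x3), (o2, x2), (o1, x1)] @ V))"
proof -
  obtain a b c where x: "x1 = (a, e)" "x2 = (b, e)" "x3 = (c, e)"
    using sgn by (cases x1; cases x2; cases x3) auto
  have "good (fill ([(o1, x1), (o2, x2), (o3, x3)] @ W @ V))"
    using good by (subst good_fill_cong[of _ "W @ [(o1, x1), (o2, x2), (o3, x3)] @ V"]) auto
  then have "good (fill (W @ V))"
    and abc: "a \<noteq> b" "a \<noteq> c" "b \<noteq> c" "{a, b, c} \<inter> fst ` set (fill (W @ V)) = {}"
    by (auto simp: good_fill_Cons fst_set_fill x)
  then obtain D where D: "gauss_diagram D" "chords D = fill (W @ V)"
    by (auto simp: good_def)
  obtain u' w' y' z' where D': "D = u' @ w' @ y' @ z'"
    and ch: "chords u' = u @ on_strand W h1" "chords w' = on_strand V h1 @ w @ on_strand W h2"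
      "chords y' = on_strand V h2 @ y @ on_strand W h3" "chords z' = on_strand V h3 @ z"
  proof -
    have "chords D = (u @ on_strand W h1) @ (on_strand V h1 @ w @ on_strand W h2) @
        (on_strand V h2 @ y @ on_strand W h3) @ (on_strand V h3 @ z)"
      by (simp add: D(2) fill_def)
    then show ?thesis
      unfolding chords_eq_append_conv[of _ "u @ on_strand W h1"]
        chords_eq_append_conv[of _ "on_strand V h1 @ w @ on_strand W h2"]
        chords_eq_append_conv[of _ "on_strand V h2 @ y @ on_strand W h3"]
      using that by blast
  qed
  \<comment> \<open>Strand \<open>o3\<close> carries \<open>a\<close>, \<open>b\<close>, strand
    \<open>o2\<close> carries \<open>a\<close>, \<open>c\<close>, and strand \<open>o1\<close>
    carries \<open>b\<close>, \<open>c\<close>. They are given the directions of the arcs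
    \<open>s\<^sub>1\<close>, \<open>s\<^sub>2\<close>, \<open>s\<^sub>3\<close> of R3.\<close>
  define P where "P h = (if h = o3 then [Endpoint a Tail e, Endpoint b Tail e]
    else if h = o2 then [Endpoint a Head e, Endpoint c Tail e]
    else [Endpoint b Head e, Endpoint c Head e])" for h
  have Po: "P o1 = [Endpoint b Head e, Endpoint c Head e]" "P o2 = [Endpoint a Head e, Endpoint c Tail e]"
    "P o3 = [Endpoint a Tail e, Endpoint b Tail e]"
    using o by (auto simp: P_def)
  define E where "E s = u' @ s h1 @ w' @ s h2 @ y' @ s h3 @ z'" for s :: "strand \<Rightarrow> gauss_word"
  let ?E = "Endpoint a Tail e # Endpoint a Head e # Endpoint b Tail e # Endpoint b Head e #
    Endpoint c Tail e # Endpoint c Head e # D"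
  have P_mset: "mset (P h1) + mset (P h2) + mset (P h3)
      = mset (P o1) + mset (P o2) + mset (P o3)"
    using strand_sum[OF order, of "\<lambda>h. mset (P h)"] strand_sum[OF o, of "\<lambda>h. mset (P h)"] by simp
  have "mset (E P) = (mset (P h1) + mset (P h2) + mset (P h3)) + mset D"
    by (simp add: E_def D' ac_simps)
  also have "\<dots> = mset ?E" unfolding P_mset by (simp add: Po ac_simps)
  finally have "mset (E P) = mset ?E" .
  moreover have "gauss_diagram ?E"
    using D abc by (auto simp: gauss_diagram_Cons_Cons arrows_eq_fst_chords)
  moreover have "mset (E (rev \<circ> P)) = mset (E P)" by (simp add: E_def)
  ultimately have gd: "gauss_diagram (E P)" "gauss_diagram (E (rev \<circ> P))"
    using gauss_diagram_mset_cong by metis+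
  \<comment> \<open>R3 allows its arcs in any position along the line, so only the set of the three
    arcs has to match.\<close>
  have "{P h1, P h2, P h3} = P ` {h1, h2, h3}" by simp
  also have "\<dots> = P ` {o3, o2, o1}" using strand_cover[OF order] strand_cover[OF o] by auto
  finally have "{P h1, P h2, P h3} = {P o3, P o2, P o1}" by simp
  then have "move (E P) (E (rev \<circ> P))"
    unfolding E_def o_def by (rule move.R3[OF Po(3,2,1)])
  then have "f (E (rev \<circ> P)) = f (E P)" by (rule f_move[OF gd])
  moreover have "chords (P h) = on_strand [(o1, x1), (o2, x2), (o3, x3)] h"
    "chords (rev (P h)) = on_strand [(o3, x3), (o2, x2), (o1, x1)] h" for h
  proof -
    have "h \<in> {o1, o2, o3}" using strand_cover[OF o] by auto
    then show "chords (P h) = on_strand [(o1, x1), (o2, x2), (o3, x3)] h"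
      "chords (rev (P h)) = on_strand [(o3, x3), (o2, x2), (o1, x1)] h"
      using o by (auto simp: Po x)
  qed
  then have "chords (E P) = fill (W @ [(o1, x1), (o2, x2), (o3, x3)] @ V)"
    "chords (E (rev \<circ> P)) = fill (W @ [(o3, x3), (o2, x2), (o1, x1)] @ V)"
    by (simp_all only: E_def chords_simps ch fill_def on_strand_simps(3) append_assoc o_def)
  ultimately show ?thesis using val_chords[OF gd(1)] val_chords[OF gd(2)] by simp
qed

end

section \<open>Powers of a letter and commutation of letters\<close>

context strand_context
begin

text \<open>A power of a letter. Its factors are different chords and so need different
  names.\<close>

definition copies :: "strand \<Rightarrow> sign \<Rightarrow> nat list \<Rightarrow> letter list" where
  "copies i s as = map (\<lambda>a. (i, (a, s))) as"

lemma copies_simps [simp]: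
  "copies i s [] = []" "copies i s (a # as) = (i, (a, s)) # copies i s as"
  "names (copies i s as) = set as"
  "rename g (copies i s as) = copies i s (map g as)"
  by (auto simp: copies_def names_def rename_def image_image)

lemma filter_copies:
  "filter (\<lambda>l. fst (snd l) \<notin> T) (copies i s as) = copies i s (filter (\<lambda>a. a \<notin> T) as)"
  by (simp add: copies_def filter_map o_def)

lemma good_copies:
  "good (fill (copies i s as)) \<longleftrightarrow> good (fill []) \<and> distinct as \<and> set as \<inter> base_names = {}"
  by (induction as) (auto simp: good_fill_Cons)

lemma good_fill_insert_copies:
  assumes "good (fill (W @ V))" "\<And>a. a \<in> names (W @ V) \<union> base_names \<Longrightarrow> a < N"
    "distinct as" "\<And>a. a \<in> set as \<Longrightarrow> N \<le> a"
  shows "good (fill (W @ copies i s as @ V))"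
proof -
  have "good (fill (copies i s as @ []))"
  proof -
    have "good (fill [])" using assms(1) good_fill_append[of "[]" "W @ V"] good_fill_append[of "W @ V" "[]"] by simp
    then show ?thesis using assms by (fastforce simp: good_copies)
  qed
  then show ?thesis
    using assms by (fastforce simp: good_fill_append)
qed

text \<open>Fresh names can be renamed to a standard segment above \<open>N\<close>. Thus only the
  number of copies matters, and the value becomes a function of one natural number.\<close>

lemma val_fill_copies_length:
  assumes good: "good (fill (W @ V))" and N: "\<And>a. a \<in> names (W @ V) \<union> base_names \<Longrightarrow> a < N"
    and as: "distinct as" "\<And>a. a \<in> set as \<Longrightarrow> N \<le> a"
  shows "val (fill (W @ copies i s as @ V))
    = val (fill (W @ copies i s [N..<N + length as] @ V))"
proof -
  \<comment> \<open>The renaming \<open>g\<close> fixes everything below \<open>N\<close>, where all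
    other names lie, and sends the entry of \<open>as\<close> at index \<open>j\<close> to
    \<open>N + j\<close>.\<close>
  define m where "m = map_of (zip as [N..<N + length as])"
  define g where "g a = (if a < N then a else the (m a))" for a
  have "g (as ! j) = N + j" if "j < length as" for j
  proof -
    have "m (as ! j) = Some ([N..<N + length as] ! j)"
      unfolding m_def by (rule map_of_zip_nth) (use as that in auto)
    then show ?thesis using as(2)[of "as ! j"] that by (simp add: g_def)
  qed
  then have g: "map g as = [N..<N + length as]"
    by (intro nth_equalityI) auto
  have "inj_on g (set as)"
    using g by (metis distinct_map distinct_upt)
  moreover have "N \<le> g a" if "a \<in> set as" for a
    using that g by (metis atLeastLessThan_iff image_eqI set_map set_upt)
  moreover have id: "g a = a" "a < N" if "a \<in> names (W @ V) \<union> base_names" for a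
    using N[OF that] by (simp_all add: g_def)
  ultimately have "inj_on g (set as \<union> (names (W @ V) \<union> base_names))"
    unfolding inj_on_def by (metis Un_iff leD)
  then have "val (fill (rename g (W @ copies i s as @ V))) = val (fill (W @ copies i s as @ V))"
    using id good_fill_insert_copies[OF assms] by (intro val_fill_rename) (auto simp: ac_simps)
  moreover have "rename g W = W" "rename g V = V"
    using id by (auto intro!: rename_cong_id)
  ultimately show ?thesis by (simp add: g)
qed

text \<open>Finite type is applied to the set of all \<open>k\<close> copies. Deleting
  \<open>T\<close> leaves \<open>k - card T\<close> of them; passing to complements turns deleted
  copies into remaining ones at the cost of a global sign \<open>(- 1) ^ k\<close>.\<close>

lemma val_fill_differences:
  assumes good: "good (fill (W @ V))" and N: "\<And>a. a \<in> names (W @ V) \<union> base_names \<Longrightarrow> a < N"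
    and k: "n < k"
  shows "(\<Sum>T\<in>Pow {..<k}. (- 1) ^ card T * val (fill (W @ copies i s [N..<N + card T] @ V))) = 0"
proof -
  define F where "F j = val (fill (W @ copies i s [N..<N + j] @ V))" for j
  define S where "S = {N..<N + k}"
  let ?U = "fill (W @ copies i s [N..<N + k] @ V)"
  have S: "finite S" "card S = k" by (simp_all add: S_def)
  have dis: "names W \<inter> S = {}" "names V \<inter> S = {}" "base_names \<inter> S = {}"
    using N by (fastforce simp: S_def)+
  have del: "val (filter (\<lambda>x. fst x \<notin> T) ?U) = F (card (S - T))" if T: "T \<subseteq> S" for T
  proof -
    have id: "filter (\<lambda>x. fst x \<notin> T) v = v" if "v \<in> {u, w, y, z}" for v
      using that dis(3) T by (intro filter_True) (auto simp: base_names_def)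
    have "names W \<inter> T = {}" "names V \<inter> T = {}" using dis T by auto
    note fW = this[THEN filter_id_on_names]
    let ?as = "filter (\<lambda>a. a \<notin> T) [N..<N + k]"
    have "filter (\<lambda>x. fst x \<notin> T) ?U = fill (filter (\<lambda>l. fst (snd l) \<notin> T) (W @ copies i s [N..<N + k] @ V))"
      by (simp add: fill_def filter_on_strand id del: on_strand_simps filter_append) (simp add: id filter_on_strand del: on_strand_simps)
    also have "\<dots> = fill (W @ copies i s ?as @ V)"
      by (simp add: fW filter_copies)
    moreover have "val (fill (W @ copies i s ?as @ V)) = F (length ?as)"
      unfolding F_def by (rule val_fill_copies_length[OF good N]) auto
    ultimately have "val (filter (\<lambda>x. fst x \<notin> T) ?U) = F (length ?as)" by (simp only:)
    moreover have "set ?as = S - T" by (auto simp: S_def)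
    then have "length ?as = card (S - T)" by (metis distinct_card distinct_filter distinct_upt)
    ultimately show ?thesis by simp
  qed
  have "good ?U" by (rule good_fill_insert_copies[OF good N]) auto
  then have "0 = (\<Sum>T\<in>Pow S. (- 1) ^ card T * val (filter (\<lambda>x. fst x \<notin> T) ?U))"
    using k S(2) by (intro val_finite_type[symmetric]) (auto simp: fst_set_fill S_def)
  also have "\<dots> = (\<Sum>T\<in>Pow S. (- 1) ^ k * ((- 1) ^ card (S - T) * F (card (S - T))))"
  proof (rule sum.cong)
    fix T assume "T \<in> Pow S"
    then have T: "T \<subseteq> S" by simp
    then have "card T + card (S - T) = k"
      using S by (metis card_Diff_subset card_mono finite_subset le_add_diff_inverse)
    then have "(- 1 :: rat) ^ k = (- 1) ^ card T * (- 1) ^ card (S - T)"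
      by (metis power_add)
    then have "(- 1) ^ k * (- 1) ^ card (S - T) = (- 1 :: rat) ^ card T"
      by (simp flip: power_add) (simp add: power_add flip: power_mult_distrib)
    then show "(- 1) ^ card T * val (filter (\<lambda>x. fst x \<notin> T) ?U)
        = (- 1) ^ k * ((- 1) ^ card (S - T) * F (card (S - T)))"
      using del[OF T] by (simp flip: mult.assoc)
  qed simp
  also have "\<dots> = (- 1) ^ k * (\<Sum>T\<in>Pow S. (- 1) ^ card T * F (card T))"
    using sum_Pow_complement[OF S(1), of "\<lambda>T. (- 1) ^ card T * F (card T)"]
    by (simp flip: sum_distrib_left)
  finally have "(\<Sum>T\<in>Pow S. (- 1) ^ card T * F (card T)) = 0" by simp
  then show ?thesis
    using sum_Pow_card[OF S(1), of "\<lambda>j. (- 1) ^ j * F j"]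
      sum_Pow_card[of "{..<k}" "\<lambda>j. (- 1) ^ j * F j"] S(2) by (simp add: F_def)
qed

text \<open>Write \<open>A\<close>, \<open>B\<close>, \<open>C\<close> for letters of equal sign omitting three different strands.  Then
  \<open>AABC = ACBA = BCAA\<close> by two R3 moves.\<close>

lemma val_fill_even_copies_commute:
  assumes "even (length as)" "good (fill (W @ copies i s as @ [B, C] @ V))"
    "i \<noteq> fst B" "i \<noteq> fst C" "fst B \<noteq> fst C" "snd (snd B) = s" "snd (snd C) = s"
  shows "val (fill (W @ copies i s as @ [B, C] @ V)) = val (fill (W @ [B, C] @ copies i s as @ V))"
  using assms
proof (induction as arbitrary: W rule: induct_list012)
  case (3 a b as)
  obtain j x k x' where BC: "B = (j, x)" "C = (k, x')" by (cases B; cases C)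
  let ?A = "(i, (a, s))" and ?A' = "(i, (b, s))" and ?R = "copies i s as @ V"
  have good: "good (fill U)" if "mset U = mset (W @ [?A, ?A', B, C] @ ?R)" for U
    using 3(4) by (subst good_fill_cong[of _ "W @ copies i s (a # b # as) @ [B, C] @ V"]) (simp_all add: that)
  \<comment> \<open>The later copies pass \<open>B\<close>, \<open>C\<close> by induction; then
    \<open>?A'\<close> and \<open>?A\<close> follow by one R3 move each, the first of which turns
    \<open>B\<close>, \<open>C\<close> into \<open>C\<close>, \<open>B\<close> and the second turns
    it back.\<close>
  have "val (fill (W @ copies i s (a # b # as) @ [B, C] @ V))
      = val (fill ((W @ [?A, ?A']) @ copies i s as @ [B, C] @ V))" by simp
  also have "\<dots> = val (fill ((W @ [?A, ?A']) @ [B, C] @ copies i s as @ V))"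
    using 3(3,5-) by (intro 3(1) good) auto
  also have "\<dots> = val (fill ((W @ [?A]) @ [?A', B, C] @ ?R))" by simp
  also have "\<dots> = val (fill ((W @ [?A]) @ [C, B, ?A'] @ ?R))"
    unfolding BC using 3(5-) by (intro val_fill_R3[where e = s] good) (auto simp: BC)
  also have "\<dots> = val (fill (W @ [?A, C, B] @ (?A' # ?R)))" by simp
  also have "\<dots> = val (fill (W @ [B, C, ?A] @ (?A' # ?R)))"
    unfolding BC using 3(5-) by (intro val_fill_R3[where e = s] good) (auto simp: BC)
  finally show ?case by simp
qed simp_all

fun negate :: "sign \<Rightarrow> sign" where
  "negate Positive = Negative"
| "negate Negative = Positive"

lemma negate_neq [simp]: "negate s \<noteq> s" "s \<noteq> negate s"
  by (cases s; simp)+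

lemma fresh_bound:
  obtains N where "\<And>a. a \<in> names W \<union> base_names \<Longrightarrow> a < N"
proof -
  have "finite (names W \<union> base_names)" by (simp add: names_def base_names_def)
  then obtain N where "\<forall>a\<in>names W \<union> base_names. a < N"
    unfolding finite_nat_set_iff_bounded by (elim exE)
  then show ?thesis by (intro that) (erule bspec)
qed

text \<open>With \<open>X\<close> an inverse of the letter \<open>Y\<close> on the third pair of
  strands, the chain is \<open>BC = XYBC = XBCY = XYCB = CB\<close>. The outer equalities are R2,
  the third is R3, and the second is the polynomial argument.\<close>

lemma val_fill_commute_same_sign:
  assumes good: "good (fill (W @ [B, C] @ V))"
    and BC: "fst B \<noteq> fst C" "snd (snd B) = s" "snd (snd C) = s"
  shows "val (fill (W @ [B, C] @ V)) = val (fill (W @ [C, B] @ V))"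
proof -
  obtain i where i: "i \<noteq> fst B" "i \<noteq> fst C"
    using BC(1) by (cases "fst B"; cases "fst C") (metis strand.distinct)+
  obtain j x k x' where BC': "B = (j, x)" "C = (k, x')" by (cases B; cases C)
  obtain N where N: "a < N" if "a \<in> names (W @ [B, C] @ V) \<union> base_names" for a
    using fresh_bound[of "W @ [B, C] @ V"] by metis
  \<comment> \<open>\<open>X\<close> has the opposite sign, so that R2 cancels it against a copy on
    the same strands. It takes the name \<open>N\<close>, and the copies start at
    \<open>Suc N\<close>.\<close>
  define X where "X = (i, (N, negate s))"
  define A where "A = copies i s"
  have good': "good (fill U)" if "mset U = mset (W @ [X] @ A as @ [B, C] @ V)"
    "distinct as" "\<And>a. a \<in> set as \<Longrightarrow> Suc N \<le> a" for U as
  proof -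
    have g1: "good (fill (W @ copies i (negate s) [N] @ [B, C] @ V))"
      by (rule good_fill_insert_copies[OF good N]) auto
    have "good (fill ((W @ [X]) @ copies i s as @ [B, C] @ V))"
      using that(2,3) g1 N
      by (intro good_fill_insert_copies[where N = "Suc N"]) (auto simp: X_def less_Suc_eq)
    then show ?thesis
      using good_fill_cong[OF that(1)] by (simp add: A_def)
  qed
  \<comment> \<open>The failure of \<open>m\<close> copies to pass \<open>B\<close>,
    \<open>C\<close>, with \<open>X\<close> already in place. It vanishes for even \<open>m\<close>
    by R3; the case \<open>m = 1\<close> is the one wanted.\<close>
  define F where "F m = val (fill ((W @ [X]) @ A [Suc N..<Suc N + m] @ [B, C] @ V))
    - val (fill ((W @ [X, B, C]) @ A [Suc N..<Suc N + m] @ V))" for m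
  have "F 1 = 0"
  proof (rule vanishing_differences_imp_zero)
    fix m :: nat assume m: "n < m"
    have N': "a < Suc N" if "a \<in> names ((W @ [X]) @ [B, C] @ V) \<union> base_names" for a
      using that N by (auto simp: X_def less_Suc_eq)
    have N'': "a < Suc N" if "a \<in> names ((W @ [X, B, C]) @ V) \<union> base_names" for a
      using that N by (auto simp: X_def less_Suc_eq)
    have "good (fill ((W @ [X]) @ [B, C] @ V))" "good (fill ((W @ [X, B, C]) @ V))"
      by (rule good'[of _ "[]"]; simp add: A_def)+
    note val_fill_differences[OF this(1) N' m, where i = i and s = s]
      val_fill_differences[OF this(2) N'' m, where i = i and s = s]
    then show "(\<Sum>T\<in>Pow {..<m}. (- 1) ^ card T * F (card T)) = 0"
      by (simp only: F_def A_def right_diff_distrib sum_subtractf diff_self)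
  next
    fix m
    have "good (fill ((W @ [X]) @ A [Suc N..<Suc N + 2 * m] @ [B, C] @ V))"
      by (rule good'[of _ "[Suc N..<Suc N + 2 * m]"]) auto
    then show "F (2 * m) = 0"
      unfolding F_def A_def
      by (subst val_fill_even_copies_commute) (use BC i in auto)
  qed
  define Y where "Y = (i, (Suc N, s))"
  have good_Y: "good (fill U)" if "mset U = mset (W @ [X, Y, B, C] @ V)" for U
    by (rule good'[of _ "[Suc N]"]) (simp_all add: that A_def Y_def)
  have cancel: "val (fill (W @ [X, Y] @ U)) = val (fill (W @ U))"
    if "mset U = mset ([B, C] @ V)" for U
    unfolding X_def Y_def using that
    by (intro val_fill_R2) (auto intro!: good_Y simp: X_def Y_def)
  have "val (fill (W @ [B, C] @ V)) = val (fill (W @ [X, Y] @ [B, C] @ V))"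
    by (rule cancel[symmetric]) simp
  also have "\<dots> = val (fill (W @ [X, B, C, Y] @ V))"
    using \<open>F 1 = 0\<close> by (simp add: F_def A_def Y_def)
  also have "\<dots> = val (fill ((W @ [X]) @ [B, C, Y] @ V))" by simp
  also have "\<dots> = val (fill ((W @ [X]) @ [Y, C, B] @ V))"
    unfolding BC' Y_def using BC i
    by (intro val_fill_R3[where e = s]) (auto intro!: good_Y simp: BC' Y_def)
  also have "\<dots> = val (fill (W @ [X, Y] @ [C, B] @ V))" by simp
  also have "\<dots> = val (fill (W @ [C, B] @ V))" by (rule cancel) simp
  finally show ?thesis .
qed

text \<open>For opposite signs, replace \<open>BC\<close> by \<open>C'C''BC = C'BC''C = C'B\<close> where \<open>C'\<close> is a copy of
  \<open>C\<close> and \<open>C''\<close> a copy with the opposite sign; renaming turns \<open>C'\<close> into \<open>C\<close>.\<close>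

lemma val_fill_commute:
  assumes good: "good (fill (W @ [B, C] @ V))" and BC: "fst B \<noteq> fst C"
  shows "val (fill (W @ [B, C] @ V)) = val (fill (W @ [C, B] @ V))"
proof (cases "snd (snd B) = snd (snd C)")
  case True
  then show ?thesis using val_fill_commute_same_sign[OF good BC, of "snd (snd C)"] by simp
next
  case False
  obtain i c s where C: "C = (i, (c, s))" by (cases C) auto
  define t where "t = snd (snd B)"
  have ts: "t \<noteq> s" "snd (snd B) = t" using False by (auto simp: t_def C)
  obtain N where N: "a < N" if "a \<in> names (W @ [B, C] @ V) \<union> base_names" for a
    using fresh_bound[of "W @ [B, C] @ V"] by metis
  \<comment> \<open>These are the \<open>C'\<close> and \<open>C''\<close> of the explanation above.
    Since \<open>Y\<close> has the sign of \<open>B\<close>, the same-sign case exchanges the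
    two.\<close>
  define X Y where "X = (i, (N, s))" "Y = (i, (Suc N, t))"
  have good': "good (fill (X # Y # W @ [B, C] @ V))"
    using good N by (fastforce simp: X_Y_def good_fill_Cons)
  have good1: "good (fill U)" if "mset U = mset (X # Y # W @ [B, C] @ V)" for U
    using good' good_fill_cong[OF that] by simp
  have good2: "good (fill (W @ [X, B] @ V))"
  proof -
    have "good (fill (Y # C # W @ [X, B] @ V))" by (rule good1) simp
    then show ?thesis by (simp add: good_fill_Cons)
  qed
  have "val (fill (W @ [B, C] @ V)) = val (fill (W @ [X, Y] @ [B, C] @ V))"
    unfolding X_Y_def using ts
    by (intro val_fill_R2[symmetric]) (auto intro!: good1 simp: X_Y_def)
  also have "\<dots> = val (fill ((W @ [X]) @ [Y, B] @ (C # V)))" by simp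
  also have "\<dots> = val (fill ((W @ [X]) @ [B, Y] @ (C # V)))"
    using BC ts by (intro val_fill_commute_same_sign[where s = t]) (auto intro!: good1 simp: X_Y_def C)
  also have "\<dots> = val (fill ((W @ [X, B]) @ [Y, C] @ V))" by simp
  also have "\<dots> = val (fill ((W @ [X, B]) @ V))"
    unfolding X_Y_def C using ts
    by (intro val_fill_R2) (auto intro!: good1 simp: X_Y_def C)
  \<comment> \<open>The original \<open>C\<close> has been cancelled, so its name \<open>c\<close>
    is free again and can be given to \<open>X\<close>.\<close>
  also have "\<dots> = val (fill (rename (\<lambda>a. if a = N then c else a) (W @ [X, B] @ V)))"
  proof -
    have "good (fill (C # W @ [B] @ V))"
      using good good_fill_cong[of "C # W @ [B] @ V" "W @ [B, C] @ V"] by simp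
    then have c: "c \<notin> names (W @ [B] @ V) \<union> base_names" by (auto simp: good_fill_Cons C)
    have "N \<notin> names (W @ [B] @ V) \<union> base_names" using N by fastforce
    then show ?thesis
      using c good2 by (subst val_fill_rename) (auto simp: X_Y_def inj_on_def)
  qed
  also have "rename (\<lambda>a. if a = N then c else a) (W @ [X, B] @ V) = W @ [C, B] @ V"
  proof -
    have "rename (\<lambda>a. if a = N then c else a) U = U" if "names U \<subseteq> names (W @ [B, C] @ V)" for U
      using that N by (intro rename_cong_id) fastforce
    moreover have "names W \<subseteq> names (W @ [B, C] @ V)" "names [B] \<subseteq> names (W @ [B, C] @ V)"
      "names V \<subseteq> names (W @ [B, C] @ V)" by auto
    ultimately have "rename (\<lambda>a. if a = N then c else a) W = W"
      "rename (\<lambda>a. if a = N then c else a) [B] = [B]"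
      "rename (\<lambda>a. if a = N then c else a) V = V" by blast+
    then show ?thesis by (simp add: X_Y_def C)
  qed
  finally show ?thesis .
qed

end

subsection \<open>Adjacent ends may be exchanged\<close>

context virtualization_invariant_finite_type
begin

text \<open>Strands \<open>First\<close> and \<open>Second\<close> are the far ends of
  \<open>x\<close> and \<open>y\<close>, and \<open>Third\<close> is the adjacent pair. Exchanging
  the letters \<open>(Second, x)\<close> and \<open>(First, y)\<close> then changes only
  \<open>Third\<close>.\<close>

lemma val_swap:
  assumes good: "good (p @ [x, y] @ q)" and "x \<noteq> y"
  shows "val (p @ [x, y] @ q) = val (p @ [y, x] @ q)"
proof -
  define S where "S U h = (case h of First \<Rightarrow> [x] | Second \<Rightarrow> [y] | Third \<Rightarrow> U)" for U h
  have S [simp]: "S U First = [x]" "S U Second = [y]" "S U Third = U" for U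
    by (simp_all add: S_def)
  have ctx: "val (u @ S [x, y] h1 @ w @ S [x, y] h2 @ v @ S [x, y] h3 @ z)
      = val (u @ S [y, x] h1 @ w @ S [y, x] h2 @ v @ S [y, x] h3 @ z)"
    if good: "good (u @ S [x, y] h1 @ w @ S [x, y] h2 @ v @ S [x, y] h3 @ z)"
      and h: "h1 \<noteq> h2" "h1 \<noteq> h3" "h2 \<noteq> h3" for u w v z h1 h2 h3
  proof -
    interpret strand_context f n u w v z h1 h2 h3
      by unfold_locales (fact h)+
    have "S [x, y] h = on_strand [(Second, x), (First, y)] h"
      "S [y, x] h = on_strand [(First, y), (Second, x)] h" for h
      by (cases h; simp)+
    then show ?thesis
      using val_fill_commute[of "[]" "(Second, x)" "(First, y)" "[]"] good
      by (simp add: fill_def)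
  qed
  have ends: "a \<in> set (p @ q)" if a: "{a, b} = {x, y}" "a \<noteq> b" for a b
  proof -
    have "good (a # b # p @ q)"
      using good by (subst good_mset_cong[of _ "p @ [x, y] @ q"]) (use a in \<open>auto simp: doubleton_eq_iff\<close>)
    then obtain r s where "b # p @ q = r @ a # s" by (rule good_ConsE)
    then have "a \<in> set (b # p @ q)" by (metis in_set_conv_decomp)
    then show ?thesis using a by simp
  qed
  have "x \<in> set (p @ q)" "y \<in> set (p @ q)"
    using ends[of x y] ends[of y x] \<open>x \<noteq> y\<close> by auto
  \<comment> \<open>The far ends and the adjacent pair can occur along the line in six orders, one
    for each ordering of the three strands.\<close>
  then consider "x \<in> set p" "y \<in> set p" | "x \<in> set p" "y \<in> set q" | "x \<in> set q" "y \<in> set p"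
    | "x \<in> set q" "y \<in> set q" by auto
  then show ?thesis
  proof cases
    case 1
    then obtain r s where p: "p = r @ x # s" by (meson split_list)
    with 1 \<open>x \<noteq> y\<close> consider "y \<in> set r" | "y \<in> set s" by auto
    then show ?thesis
    proof cases
      case 1
      then obtain a b where "r = a @ y # b" by (meson split_list)
      then show ?thesis using good p ctx[of a Second b First s Third q] by simp
    next
      case 2
      then obtain a b where "s = a @ y # b" by (meson split_list)
      then show ?thesis using good p ctx[of r First a Second b Third q] by simp
    qed
  next
    case 2
    then obtain a b c d where "p = a @ x # b" "q = c @ y # d" by (meson split_list)
    then show ?thesis using good ctx[of a First b Third c Second d] by simp
  next
    case 3
    then obtain a b c d where "p = a @ y # b" "q = c @ x # d" by (meson split_list)
    then show ?thesis using good ctx[of a Second b Third c First d] by simp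
  next
    case 4
    then obtain r s where q: "q = r @ x # s" by (meson split_list)
    with 4 \<open>x \<noteq> y\<close> consider "y \<in> set r" | "y \<in> set s" by auto
    then show ?thesis
    proof cases
      case 1
      then obtain a b where "r = a @ y # b" by (meson split_list)
      then show ?thesis using good q ctx[of p Third a Second b First s] by simp
    next
      case 2
      then obtain a b where "s = a @ y # b" by (meson split_list)
      then show ?thesis using good q ctx[of p Third r First a Second b] by simp
    qed
  qed
qed

text \<open>The second end of \<open>x\<close> travels left by \<open>val_swap\<close> until it
  stands next to the first end, where R1 removes the chord.\<close>

lemma val_remove_chord:
  assumes "good (x # p @ x # q)" "x \<notin> set p"
  shows "val (x # p @ x # q) = val (p @ q)"
  using assms
proof (induction p arbitrary: q rule: rev_induct)
  case Nil
  then show ?case using val_R1[of "[]" x q] by simp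
next
  case (snoc y p)
  have "val (x # (p @ [y]) @ x # q) = val ((x # p) @ [y, x] @ q)" by simp
  also have "\<dots> = val ((x # p) @ [x, y] @ q)"
    using snoc.prems by (intro val_swap) auto
  also have "\<dots> = val (x # p @ x # y # q)" by simp
  also have "\<dots> = val (p @ y # q)"
  proof (rule snoc.IH)
    show "good (x # p @ x # y # q)"
      using snoc.prems(1) by (subst good_mset_cong[of _ "x # (p @ [y]) @ x # q"]) simp_all
    show "x \<notin> set p" using snoc.prems(2) by simp
  qed
  finally show ?case by simp
qed

lemma val_eq_val_Nil: "good U \<Longrightarrow> val U = val []"
proof (induction "length U" arbitrary: U rule: less_induct)
  case less
  show ?case
  proof (cases U)
    case (Cons x U')
    with less.prems obtain p q where U': "U' = p @ x # q" "x \<notin> set p"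
      by (auto elim: good_ConsE)
    have "good (x # x # p @ q)"
      using less.prems by (subst good_mset_cong[of _ U]) (auto simp: Cons U')
    then have "val (p @ q) = val []"
      by (intro less.hyps) (auto simp: good_Cons_Cons Cons U')
    then show ?thesis
      using val_remove_chord[of x p q] less.prems U' by (simp add: Cons)
  qed simp
qed

lemma f_eq_f_Nil: "gauss_diagram D \<Longrightarrow> f D = f []"
  using val_eq_val_Nil[of "chords D"] val_chords[of D] val_chords[OF gauss_diagram_Nil]
  by (auto simp: good_def)

end

section \<open>Passage to virtual knots and long virtual knots\<close>

lemma virtualization_invariant_imp_constant:
  fixes v :: "'k \<Rightarrow> rat"
  assumes surj: "\<And>K. \<exists>D. gauss_diagram D \<and> K = cls D"
    and move: "\<And>D D'. gauss_diagram D \<Longrightarrow> gauss_diagram D' \<Longrightarrow> move D D' \<Longrightarrow> cls D = cls D'"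
    and ft: "GPV_finite_type cls v" and virt: "virtualization_invariant cls v"
  shows "is_constant v"
proof -
  obtain n where n: "GPV_finite_type_le cls n v"
    using ft by (auto simp: GPV_finite_type_def)
  interpret virtualization_invariant_finite_type "\<lambda>D. v (cls D)" n
  proof
    show "v (cls D') = v (cls D)" if "gauss_diagram D" "gauss_diagram D'" "move D D'" for D D'
      using move[OF that] by simp
    show "(\<Sum>T\<in>Pow S. (- 1) ^ card T * v (cls (delete_arrows T D))) = 0"
      if "gauss_diagram D" "S \<subseteq> arrows D" "n < card S" for D S
      using n that by (auto simp: GPV_finite_type_le_def)
    show "v (cls (virtualize a D)) = v (cls D)" if "gauss_diagram D" "a \<in> arrows D" for D a
      using virt that unfolding virtualization_invariant_def virtualization_related_def by metis
  qed
  have "v K = v (cls [])" for K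
    using surj[of K] f_eq_f_Nil by auto
  then show ?thesis by (auto simp: is_constant_def)
qed

lemma knot_of_surj: "\<exists>D. gauss_diagram D \<and> K = knot_of D"
proof (intro exI conjI)
  show "gauss_diagram (rep_virtual_knot K)"
    using Quotient3_rep_reflp[OF Quotient3_virtual_knot, of K] by (simp add: closed_equiv_def)
  show "K = knot_of (rep_virtual_knot K)"
    using Quotient3_abs_rep[OF Quotient3_virtual_knot] by simp
qed

lemma knot_of_move:
  assumes "gauss_diagram D" "gauss_diagram D'" "move D D'"
  shows "knot_of D = knot_of D'"
  using assms by (intro Quotient3_rel_abs[OF Quotient3_virtual_knot])
    (auto simp: closed_equiv_def intro!: r_into_equivclp)

lemma long_knot_of_surj: "\<exists>D. gauss_diagram D \<and> K = long_knot_of D"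
proof (intro exI conjI)
  show "gauss_diagram (rep_long_virtual_knot K)"
    using Quotient3_rep_reflp[OF Quotient3_long_virtual_knot, of K] by (simp add: long_equiv_def)
  show "K = long_knot_of (rep_long_virtual_knot K)"
    using Quotient3_abs_rep[OF Quotient3_long_virtual_knot] by simp
qed

lemma long_knot_of_move:
  assumes "gauss_diagram D" "gauss_diagram D'" "move D D'"
  shows "long_knot_of D = long_knot_of D'"
  using assms by (intro Quotient3_rel_abs[OF Quotient3_long_virtual_knot])
    (auto simp: long_equiv_def intro!: r_into_equivclp)

text \<open>The existence of \<open>K\<close> and \<open>K'\<close> is the contrapositive of
  constancy, once \<open>virtualization_invariant\<close> is unfolded.\<close>

theorem theorem1:
  "(\<forall>v :: virtual_knot \<Rightarrow> rat. GPV_finite_type knot_of v \<longrightarrow>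
      (virtualization_invariant knot_of v \<longrightarrow> is_constant v) \<and>
      (\<not> is_constant v \<longrightarrow> (\<exists>K K'. virtualization_related knot_of K K' \<and> v K \<noteq> v K'))) \<and>
   (\<forall>v :: long_virtual_knot \<Rightarrow> rat. GPV_finite_type long_knot_of v \<longrightarrow>
      (virtualization_invariant long_knot_of v \<longrightarrow> is_constant v) \<and>
      (\<not> is_constant v \<longrightarrow> (\<exists>K K'. virtualization_related long_knot_of K K' \<and> v K \<noteq> v K')))"
  using virtualization_invariant_imp_constant[OF knot_of_surj knot_of_move]
    virtualization_invariant_imp_constant[OF long_knot_of_surj long_knot_of_move]
  unfolding virtualization_invariant_def by blast

end
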